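(* Let $m,n$ be distinct square-free rational integers such that $K=\mathbb{Q}(\sqrt{m},\sqrt{n})$ is a quartic number field, let $\mathcal{A}=\mathbb{Z}[\sqrt{m},\sqrt{n}]$, and let $\sigma,\tau$ be any two different non-zero ring endomorphisms of $\mathcal{A}$. Then the $\mathbb{Z}$-module $\mathcal{D}_{(\sigma,\tau)}(\mathcal{A})$ is finitely generated of rank $4$.
   Context: $\mathcal{D}_{(\sigma,\tau)}(\mathcal{A})$ is the $\mathbb{Z}$-module (under pointwise operations) of all $(\sigma,\tau)$-derivations of $\mathcal{A}$, i.e. of all $\mathbb{Z}$-linear maps $D:\mathcal{A}\to\mathcal{A}$ with $D(xy)=D(x)\tau(y)+\sigma(x)D(y)$ for all $x,y\in\mathcal{A}$. *)

theory Defs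
  imports
    "HOL-Algebra.Algebra"
    "HOL-Algebra.Algebraic_Closure_Type"
    "HOL-Computational_Algebra.Squarefree"
begin

text \<open>
  Ring endomorphisms are not required to be unital (unlike \<open>ring_hom\<close>), so that "non-zero" is a
  genuine hypothesis. Values outside the carrier are unconstrained.
\<close>

definition ring_endos :: "('a, 'b) ring_scheme \<Rightarrow> ('a \<Rightarrow> 'a) set" where
  "ring_endos R = {h \<in> carrier R \<rightarrow> carrier R.
     (\<forall>x\<in>carrier R. \<forall>y\<in>carrier R. h (x \<oplus>\<^bsub>R\<^esub> y) = h x \<oplus>\<^bsub>R\<^esub> h y) \<and>
     (\<forall>x\<in>carrier R. \<forall>y\<in>carrier R. h (x \<otimes>\<^bsub>R\<^esub> y) = h x \<otimes>\<^bsub>R\<^esub> h y)}"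

text \<open>
  Derivations are extensional functions (equal to \<open>undefined\<close> off the carrier), so that
  HOL-equality of derivations is equality of maps on the ring.
\<close>

definition st_derivations ::
    "('a, 'b) ring_scheme \<Rightarrow> ('a \<Rightarrow> 'a) \<Rightarrow> ('a \<Rightarrow> 'a) \<Rightarrow> ('a \<Rightarrow> 'a) set" where
  "st_derivations R \<sigma> \<tau> = {D \<in> carrier R \<rightarrow>\<^sub>E carrier R.
     (\<forall>x\<in>carrier R. \<forall>y\<in>carrier R. D (x \<oplus>\<^bsub>R\<^esub> y) = D x \<oplus>\<^bsub>R\<^esub> D y) \<and>
     (\<forall>k::int. \<forall>x\<in>carrier R. D (add_pow R k x) = add_pow R k (D x)) \<and>
     (\<forall>x\<in>carrier R. \<forall>y\<in>carrier R.
        D (x \<otimes>\<^bsub>R\<^esub> y) = (D x \<otimes>\<^bsub>R\<^esub> \<tau> y) \<oplus>\<^bsub>R\<^esub> (\<sigma> x \<otimes>\<^bsub>R\<^esub> D y))}"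

text \<open>
  The fields \<open>monoid.mult\<close> and \<open>monoid.one\<close> are present only because module records extend ring records; they
  play no role in the module structure.
\<close>

definition st_derivation_module ::
    "('a, 'b) ring_scheme \<Rightarrow> ('a \<Rightarrow> 'a) \<Rightarrow> ('a \<Rightarrow> 'a) \<Rightarrow> (int, 'a \<Rightarrow> 'a) module" where
  "st_derivation_module R \<sigma> \<tau> =
     \<lparr>carrier = st_derivations R \<sigma> \<tau>,
      monoid.mult = undefined,
      monoid.one = undefined,
      ring.zero = (\<lambda>x\<in>carrier R. \<zero>\<^bsub>R\<^esub>),
      ring.add = (\<lambda>D E. \<lambda>x\<in>carrier R. D x \<oplus>\<^bsub>R\<^esub> E x),
      module.smult = (\<lambda>k D. \<lambda>x\<in>carrier R. add_pow R k (D x))\<rparr>"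

definition module_fin_gen :: "('r, 'x) ring_scheme \<Rightarrow> ('r, 'm, 'y) module_scheme \<Rightarrow> bool" where
  "module_fin_gen R M \<longleftrightarrow> (\<exists>S. finite S \<and> S \<subseteq> carrier M \<and>
     (\<forall>x\<in>carrier M. \<exists>c \<in> S \<rightarrow> carrier R. x = (\<Oplus>\<^bsub>M\<^esub>v\<in>S. c v \<odot>\<^bsub>M\<^esub> v)))"

definition module_lin_indep ::
    "('r, 'x) ring_scheme \<Rightarrow> ('r, 'm, 'y) module_scheme \<Rightarrow> 'm set \<Rightarrow> bool" where
  "module_lin_indep R M S \<longleftrightarrow> S \<subseteq> carrier M \<and>
     (\<forall>F c. finite F \<and> F \<subseteq> S \<and> c \<in> F \<rightarrow> carrier R \<and>
        (\<Oplus>\<^bsub>M\<^esub>v\<in>F. c v \<odot>\<^bsub>M\<^esub> v) = \<zero>\<^bsub>M\<^esub> \<longrightarrow> (\<forall>v\<in>F. c v = \<zero>\<^bsub>R\<^esub>))"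

text \<open>
  The rank of a module is the maximal size of a linearly independent subset. Bounding the finite
  independent subsets suffices, since subsets of independent sets are independent.
\<close>

definition module_has_rank ::
    "('r, 'x) ring_scheme \<Rightarrow> ('r, 'm, 'y) module_scheme \<Rightarrow> nat \<Rightarrow> bool" where
  "module_has_rank R M n \<longleftrightarrow>
     (\<exists>S. module_lin_indep R M S \<and> finite S \<and> card S = n) \<and>
     (\<forall>S. module_lin_indep R M S \<and> finite S \<longrightarrow> card S \<le> n)"

abbreviation complex_field :: "complex ring" where
  "complex_field \<equiv> ring_of_type_algebra"

text \<open>
  The subfield \<open>\<rat>(\<surd>m, \<surd>n)\<close> and the subring \<open>\<int>[\<surd>m, \<surd>n]\<close> of the complex numbers; replacing
  a square root by its negative does not change either of them.
\<close>

definition biquad_field :: "int \<Rightarrow> int \<Rightarrow> complex set" where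
  "biquad_field m n = generate_field complex_field {csqrt (of_int m), csqrt (of_int n)}"

definition biquad_ring :: "int \<Rightarrow> int \<Rightarrow> complex ring" where
  "biquad_ring m n =
     complex_field\<lparr>carrier := generate_ring complex_field {csqrt (of_int m), csqrt (of_int n)}\<rparr>"

lemma st_derivation_module_is_module:
  assumes "cring R" "\<sigma> \<in> carrier R \<rightarrow> carrier R" "\<tau> \<in> carrier R \<rightarrow> carrier R"
  shows "Module.module int_ring (st_derivation_module R \<sigma> \<tau>)"
proof -
  interpret R: cring R by fact
  note cl = PiE_mem[of _ "carrier R" "\<lambda>_. carrier R"]
    funcset_mem[OF assms(2)] funcset_mem[OF assms(3)]
  let ?M = "st_derivation_module R \<sigma> \<tau>"
  note [simp] = st_derivation_module_def
  have add: "(\<lambda>x\<in>carrier R. D x \<oplus>\<^bsub>R\<^esub> E x) \<in> st_derivations R \<sigma> \<tau>"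
    if "D \<in> st_derivations R \<sigma> \<tau>" "E \<in> st_derivations R \<sigma> \<tau>" for D E
    using that unfolding st_derivations_def
    by (auto simp: cl R.add.int_pow_distrib R.l_distr R.r_distr R.add.m_ac)
  have smult: "(\<lambda>x\<in>carrier R. add_pow R k (D x)) \<in> st_derivations R \<sigma> \<tau>"
    if "D \<in> st_derivations R \<sigma> \<tau>" for D and k :: int
    using that unfolding st_derivations_def
    by (auto simp: cl R.add.int_pow_distrib R.add.int_pow_pow mult.commute
        R.add_pow_ldistr_int R.add_pow_rdistr_int)
  have zero: "(\<lambda>x\<in>carrier R. \<zero>\<^bsub>R\<^esub>) \<in> st_derivations R \<sigma> \<tau>"
    unfolding st_derivations_def by (auto simp: cl)
  have D: "D \<in> carrier R \<rightarrow>\<^sub>E carrier R" "D \<in> extensional (carrier R)"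
    if "D \<in> st_derivations R \<sigma> \<tau>" for D
    using that by (auto simp: st_derivations_def PiE_def)
  have inv: "\<exists>E\<in>st_derivations R \<sigma> \<tau>. (\<lambda>x\<in>carrier R. E x \<oplus>\<^bsub>R\<^esub> D x) = (\<lambda>x\<in>carrier R. \<zero>\<^bsub>R\<^esub>)"
    if "D \<in> st_derivations R \<sigma> \<tau>" for D
    by (rule bexI[OF _ smult[OF that, of "-1"]])
      (use D[OF that] in \<open>auto simp: cl R.add.int_pow_neg R.l_neg intro!: restrict_ext\<close>)
  have ag: "abelian_group ?M"
    by (rule abelian_groupI)
      (auto simp: add zero inv cl D R.add.m_ac intro!: restrict_ext extensionalityI[of _ "carrier R"])
  show ?thesis
    by (rule moduleI[OF int.cring_axioms ag])
      (auto simp: smult cl D R.add.int_pow_mult R.add.int_pow_pow R.add.int_pow_distrib mult.commute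
        intro!: restrict_ext extensionalityI[of _ "carrier R"])
qed

end

theory Submission
  imports Defs
begin

text \<open>
  Commutativity forces \<open>D x (\<tau> y - \<sigma> y) = D y (\<tau> x - \<sigma> x)\<close> for every \<open>(\<sigma>, \<tau>)\<close>-derivation \<open>D\<close>, so
  if \<open>\<tau> y \<noteq> \<sigma> y\<close>, then \<open>D = c (\<tau> - \<sigma>)\<close> with \<open>c = D y / (\<tau> y - \<sigma> y)\<close>, and evaluation at \<open>y\<close> identifies
  the module with the set of all \<open>d\<close> such that \<open>d (\<tau> x - \<sigma> x) / (\<tau> y - \<sigma> y)\<close> lies in the ring for all \<open>x\<close>.
  Write \<open>a = \<surd>m\<close> and \<open>b = \<surd>n\<close>. Both endomorphisms map \<open>a\<close> to \<open>\<plusminus>a\<close> and \<open>b\<close> to \<open>\<plusminus>b\<close>. If they agree on \<open>a\<close> or on \<open>b\<close>,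
  the set is the whole ring, with basis \<open>1, a, b, a b\<close>; if they differ on both, it consists of the \<open>d\<close>
  in the ring with \<open>d b / a\<close> in the ring and has basis \<open>m, a, (m / gcd m n) b, a b\<close>.
\<close>

section \<open>Subrings and subfields of the complex numbers\<close>

lemma ring_of_type_algebra_simps [simp]:
  "carrier (ring_of_type_algebra :: 'a :: ring_1 ring) = UNIV"
  "x \<otimes>\<^bsub>ring_of_type_algebra\<^esub> y = x * y"
  "x \<oplus>\<^bsub>ring_of_type_algebra\<^esub> y = x + y"
  "\<one>\<^bsub>ring_of_type_algebra\<^esub> = 1"
  "\<zero>\<^bsub>ring_of_type_algebra\<^esub> = 0"
  by (simp_all add: ring_of_type_algebra_def)

interpretation complex_field: cring complex_field
  by (rule cring_from_type_algebra)

lemma complex_field_a_inv [simp]: "\<ominus>\<^bsub>complex_field\<^esub> x = - x"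
  by (rule complex_field.minus_equality) auto

lemma complex_field_m_inv: "x \<noteq> 0 \<Longrightarrow> inv\<^bsub>complex_field\<^esub> x = inverse x"
  by (rule complex_field.comm_inv_char) auto

lemma subring_complexD:
  assumes "subring S complex_field"
  shows "0 \<in> S" "1 \<in> S" "x \<in> S \<Longrightarrow> - x \<in> S"
    "x \<in> S \<Longrightarrow> y \<in> S \<Longrightarrow> x + y \<in> S" "x \<in> S \<Longrightarrow> y \<in> S \<Longrightarrow> x * y \<in> S"
  using subringE(2,3,5-7)[OF assms] by simp_all

lemma subring_complexI:
  assumes "1 \<in> S" "\<And>x. x \<in> S \<Longrightarrow> - x \<in> S"
    "\<And>x y. x \<in> S \<Longrightarrow> y \<in> S \<Longrightarrow> x + y \<in> S" "\<And>x y. x \<in> S \<Longrightarrow> y \<in> S \<Longrightarrow> x * y \<in> S"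
  shows "subring S complex_field"
  using assms by (intro complex_field.subringI) auto

lemma subring_complex_of_int:
  assumes "subring S complex_field"
  shows "of_int k \<in> S"
proof (induction k rule: int_induct[of _ 0])
  case (step2 i)
  have "of_int i + - 1 \<in> S"
    using step2 assms by (intro subring_complexD) auto
  then show ?case by simp
qed (auto intro: subring_complexD[OF assms])

lemma subfield_complexD:
  assumes "subfield F complex_field"
  shows "subring F complex_field" "x \<in> F \<Longrightarrow> inverse x \<in> F"
proof -
  show F: "subring F complex_field"
    by (rule subfieldE(1)[OF assms])
  show "inverse x \<in> F" if "x \<in> F"
  proof (cases "x = 0")
    case False
    then show ?thesis
      using complex_field.subfield_m_inv(1)[OF assms, of x] that by (simp add: complex_field_m_inv)
  qed (use subring_complexD(1)[OF F] in simp)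
qed

lemma subfield_complexI:
  assumes "subring F complex_field" "\<And>x. x \<in> F \<Longrightarrow> x \<noteq> 0 \<Longrightarrow> inverse x \<in> F"
  shows "subfield F complex_field"
  using assms by (intro field.subfieldI'[OF field_from_type_algebra]) (auto simp: complex_field_m_inv)

lemma subfield_Rats: "subfield \<rat> complex_field"
  by (intro subfield_complexI subring_complexI) auto

text \<open>Only inverses need an idea: multiply by the conjugate \<open>x - y * t\<close>, which
  brings the denominator into \<open>F\<close>. It is allowed that \<open>t\<close> already lies in
  \<open>F\<close>.\<close>

lemma subfield_adjoin_sqrt:
  assumes F: "subfield F complex_field" and t: "t * t \<in> F"
  shows "subfield {x + y * t | x y. x \<in> F \<and> y \<in> F} complex_field" (is "subfield ?E _")
proof (rule subfield_complexI)
  note R = subring_complexD[OF subfield_complexD(1)[OF F]] and I = subfield_complexD(2)[OF F]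
  have emb: "x \<in> ?E" if "x \<in> F" for x
    using that R(1) by force
  show sub: "subring ?E complex_field"
  proof (rule subring_complexI)
    show "1 \<in> ?E"
      by (rule emb[OF R(2)])
    fix z assume "z \<in> ?E"
    then obtain x y where z: "z = x + y * t" "x \<in> F" "y \<in> F" by auto
    have "- z = - x + - y * t" by (simp add: z)
    then show "- z \<in> ?E" using z R by blast
    fix z' assume "z' \<in> ?E"
    then obtain x' y' where z': "z' = x' + y' * t" "x' \<in> F" "y' \<in> F" by auto
    have "z + z' = (x + x') + (y + y') * t" by (simp add: z z' algebra_simps)
    then show "z + z' \<in> ?E" using z z' R by blast
    have "z * z' = (x * x' + y * y' * (t * t)) + (x * y' + y * x') * t"
      by (simp add: z z' algebra_simps)
    moreover have "x * x' + y * y' * (t * t) \<in> F" "x * y' + y * x' \<in> F"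
      by (intro R(4,5) z z' t)+
    ultimately show "z * z' \<in> ?E" by blast
  qed
  fix z assume "z \<in> ?E" "z \<noteq> 0"
  from \<open>z \<in> ?E\<close> obtain x y where z: "z = x + y * t" "x \<in> F" "y \<in> F" by blast
  show "inverse z \<in> ?E"
  \<comment> \<open>The conjugate of a nonzero element can vanish only if \<open>t\<close> lies in
    \<open>F\<close>; then \<open>z\<close> is \<open>x + x\<close> and is inverted inside
    \<open>F\<close>.\<close>
  proof (cases "x - y * t = 0")
    case True
    then have "inverse z = inverse (x + x)"
      by (simp add: z)
    then show ?thesis
      by (simp only:) (intro emb I R(4) z)
  next
    case False
    define N where "N = x * x + - (y * y * (t * t))"
    have "N = z * (x - y * t)"
      by (simp add: N_def z algebra_simps)
    moreover from this have "N \<noteq> 0"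
      using False \<open>z \<noteq> 0\<close> by simp
    ultimately have "z * ((x - y * t) * inverse N) = 1"
      by (metis mult.assoc right_inverse)
    then have "inverse z = (x - y * t) * inverse N"
      by (rule inverse_unique)
    also have "\<dots> = x * inverse N + (- y * inverse N) * t"
      by (simp add: algebra_simps)
    finally have "inverse z = x * inverse N + (- y * inverse N) * t" .
    moreover have "N \<in> F"
      unfolding N_def by (intro R(3-5) z t)
    have "x * inverse N \<in> F" "- y * inverse N \<in> F"
      by (intro R(3,5) I z \<open>N \<in> F\<close>)+
    ultimately show ?thesis
      by blast
  qed
qed

section \<open>Independence from the dimension\<close>

context ring
begin

text \<open>Discard every vector that lies in the span of the later ones: the span stays the same,
  the remaining vectors are independent, and they are fewer as soon as one was discarded.\<close>

lemma independent_or_shorter_span: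
  assumes K: "subfield K R" and "set Us \<subseteq> carrier R"
  shows "independent K Us \<or>
    (\<exists>Vs. independent K Vs \<and> Span K Vs = Span K Us \<and> length Vs < length Us)"
  using assms(2)
proof (induction Us)
  case (Cons u Us)
  then have car: "u \<in> carrier R" "set Us \<subseteq> carrier R" by auto
  \<comment> \<open>Either case of the induction hypothesis yields such a list: \<open>Us\<close>
    itself or a shorter one.\<close>
  obtain Vs where Vs: "independent K Vs" "Span K Vs = Span K Us" "length Vs \<le> length Us"
      "independent K Us \<or> length Vs < length Us"
    using Cons.IH[OF car(2)] by (metis less_imp_le order_refl)
  show ?case
  proof (cases "u \<in> Span K Us")
    case True
    have "Span K (u # Us) \<subseteq> Span K Us"
      using True car Span_base_incl[OF K car(2)] by (intro mono_Span_subset[OF K]) auto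
    moreover have "Span K Us \<subseteq> Span K (u # Us)"
      using car by (intro mono_Span[OF K]) auto
    ultimately show ?thesis
      using Vs by (intro disjI2 exI[of _ Vs]) auto
  next
    case False
    then have "independent K (u # Vs)" "Span K (u # Vs) = Span K (u # Us)"
      using Vs car by (auto intro: li_Cons)
    moreover have "independent K (u # Us)" if "independent K Us"
      using that False car by (intro li_Cons)
    ultimately show ?thesis
      using Vs(4) by fastforce
  qed
qed simp

text \<open>If the list were dependent, a shorter independent list would have the same span; that
  span contains a basis of \<open>E\<close> with \<open>length Us\<close> elements, against the
  exchange bound.\<close>

lemma dimension_imp_independent:
  assumes K: "subfield K R" and "dimension (length Us) K E" "set Us \<subseteq> carrier R" "E \<subseteq> Span K Us"
  shows "independent K Us"
proof (rule ccontr)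
  assume "\<not> independent K Us"
  then obtain Vs where Vs: "independent K Vs" "Span K Vs = Span K Us" "length Vs < length Us"
    using independent_or_shorter_span[OF K assms(3)] by auto
  obtain Ws where Ws: "set Ws \<subseteq> carrier R" "independent K Ws" "length Ws = length Us" "Span K Ws = E"
    using exists_base[OF K assms(2)] by auto
  have "set Ws \<subseteq> Span K Vs"
    using Span_base_incl[OF K Ws(1)] Ws(4) Vs(2) assms(4) by auto
  then show False
    using independent_length_le[OF K Ws(2) Vs(1)] Vs(3) Ws(3) by auto
qed

end

text \<open>The field lies in the rational span of \<open>1\<close>, \<open>a\<close>,
  \<open>b\<close>, \<open>a * b\<close>, so dimension 4 forces these four elements to be
  independent over the rationals, in particular over the integers.\<close>

lemma biquad_independent:
  assumes "complex_field.dimension 4 \<rat> (biquad_field m n)"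
    and "of_int p + of_int q * csqrt (of_int m) + of_int r * csqrt (of_int n)
      + of_int s * (csqrt (of_int m) * csqrt (of_int n)) = 0"
  shows "p = 0 \<and> q = 0 \<and> r = 0 \<and> s = 0"
proof -
  define a b where "a = csqrt (of_int m)" "b = csqrt (of_int n)"
  have sq: "a * a = of_int m" "b * b = of_int n"
    using power2_csqrt[of "of_int m"] power2_csqrt[of "of_int n"]
    by (simp_all add: a_b_def power2_eq_square)
  \<comment> \<open>The tower of adjunctions gives a field \<open>E\<close> that contains both
    roots, hence the generated field. Neither adjunction is assumed to be proper.\<close>
  define F where "F = {x + y * a | x y. x \<in> \<rat> \<and> y \<in> \<rat>}"
  define E where "E = {x + y * b | x y. x \<in> F \<and> y \<in> F}"
  have F: "subfield F complex_field"
    unfolding F_def by (rule subfield_adjoin_sqrt[OF subfield_Rats]) (simp add: sq)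
  note FD = subring_complexD[OF subfield_complexD(1)[OF F]]
  have E: "subfield E complex_field"
    unfolding E_def
    by (rule subfield_adjoin_sqrt[OF F])
      (simp add: sq subring_complex_of_int subfield_complexD(1)[OF F])
  have "a \<in> F"
    unfolding F_def by (rule CollectI, rule exI[of _ 0], rule exI[of _ 1]) simp
  then have "a \<in> E"
    using FD(1) by (force simp: E_def)
  moreover have "b \<in> E"
    unfolding E_def using FD(1,2) by force
  ultimately have sub: "biquad_field m n \<subseteq> E"
    unfolding biquad_field_def by (intro field.generate_field_min_subfield1[OF field_from_type_algebra _ E]) (auto simp: a_b_def)
  have "E \<subseteq> complex_field.Span \<rat> [1, a, b, a * b]"
  proof
    fix z assume "z \<in> E"
    then obtain p q r s where "p \<in> \<rat>" "q \<in> \<rat>" "r \<in> \<rat>" "s \<in> \<rat>"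
      and z: "z = (p + q * a) + (r + s * a) * b"
      by (auto simp: E_def F_def)
    moreover from z have "z = complex_field.combine [p, q, r, s] [1, a, b, a * b]"
      by (simp add: algebra_simps)
    ultimately show "z \<in> complex_field.Span \<rat> [1, a, b, a * b]"
      by (subst complex_field.Span_eq_combine_set[OF subfield_Rats])
        (auto simp del: complex_field.combine.simps intro!: exI[of _ "[p, q, r, s]"])
  qed
  with sub assms(1) have "complex_field.independent \<rat> [1, a, b, a * b]"
    by (intro complex_field.dimension_imp_independent[OF subfield_Rats, where E = "biquad_field m n"])
      (auto simp del: complex_field.Span.simps simp: eval_nat_numeral)
  from complex_field.independent_imp_trivial_combine[OF subfield_Rats this,
      of "[of_int p, of_int q, of_int r, of_int s]"] assms(2)
  show ?thesis
    by (simp add: a_b_def algebra_simps)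
qed

section \<open>Integer coordinates in the ring generated by two square roots\<close>

lemma generate_ring_sqrt:
  assumes "a * a = of_int m" "b * b = of_int n"
  shows "generate_ring complex_field {a, b} =
    {of_int p + of_int q * a + of_int r * b + of_int s * (a * b) | p q r s. True}"
    (is "?G = ?A")
proof
  have A: "z \<in> ?A" if "z = of_int p + of_int q * a + of_int r * b + of_int s * (a * b)" for z p q r s
    using that by blast
  have "subring ?A complex_field"
  proof (rule subring_complexI)
    show "1 \<in> ?A"
      by (rule A[of _ 1 0 0 0]) simp
    fix z assume "z \<in> ?A"
    then obtain p q r s where z: "z = of_int p + of_int q * a + of_int r * b + of_int s * (a * b)"
      by blast
    show "- z \<in> ?A"
      by (rule A[of _ "- p" "- q" "- r" "- s"]) (simp add: z)
    fix z' assume "z' \<in> ?A"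
    then obtain p' q' r' s'
      where z': "z' = of_int p' + of_int q' * a + of_int r' * b + of_int s' * (a * b)"
      by blast
    show "z + z' \<in> ?A"
      by (rule A[of _ "p + p'" "q + q'" "r + r'" "s + s'"]) (simp add: z z' algebra_simps)
    show "z * z' \<in> ?A"
      \<comment> \<open>The coefficients come from expanding the product and reducing squares of
        \<open>a\<close> and \<open>b\<close>. Rewriting \<open>m\<close> and \<open>n\<close> back
        into these squares makes the equation a polynomial identity.\<close>
      by (rule A[of _ "p * p' + m * q * q' + n * r * r' + m * n * s * s'"
            "p * q' + q * p' + n * (r * s' + s * r')" "p * r' + r * p' + m * (q * s' + s * q')"
            "p * s' + s * p' + q * r' + r * q'"])
        (simp add: z z' flip: assms, simp add: algebra_simps)
  qed
  moreover have "a \<in> ?A" "b \<in> ?A"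
    by (rule A[of _ 0 1 0 0], simp, rule A[of _ 0 0 1 0], simp)
  ultimately show "?G \<subseteq> ?A"
    by (intro complex_field.generate_ring_min_subring1) auto
  have G: "subring ?G complex_field"
    by (rule complex_field.generate_ring_is_subring) simp
  have "a \<in> ?G" "b \<in> ?G"
    by (auto intro: generate_ring.incl)
  then show "?A \<subseteq> ?G"
    by (auto intro!: subring_complexD[OF G] subring_complex_of_int[OF G])
qed

section \<open>Twisted derivations of a subring of the complex numbers\<close>

lemma nontrivial_relation:
  fixes f :: "'a \<Rightarrow> nat \<Rightarrow> 'r :: idom"
  assumes "finite F" "n < card F"
  shows "\<exists>c. (\<forall>i<n. (\<Sum>x\<in>F. c x * f x i) = 0) \<and> (\<exists>x\<in>F. c x \<noteq> 0)"
  using assms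
proof (induction n arbitrary: F f)
  case 0
  then show ?case
    by (intro exI[of _ "\<lambda>_. 1"]) (auto simp: card_gt_0_iff)
next
  case (Suc n)
  show ?case
  proof (cases "\<forall>x\<in>F. f x n = 0")
    case True
    then show ?thesis
      using Suc.IH[of F f] Suc.prems by (auto simp: less_Suc_eq)
  next
    case False
    then obtain x0 where x0: "x0 \<in> F" "f x0 n \<noteq> 0" by auto
    define G where "G = F - {x0}"
    have G: "finite G" "n < card G" "F = insert x0 G" "x0 \<notin> G"
      using Suc.prems x0 by (auto simp: G_def)
    \<comment> \<open>Cross-multiplying with the pivot \<open>f x0 n\<close> eliminates the unknown
      of \<open>x0\<close> from the first \<open>n\<close> equations without a division, so the
      argument works over the integers.\<close>
    obtain c where c: "\<And>i. i < n \<Longrightarrow> (\<Sum>x\<in>G. c x * (f x0 n * f x i - f x n * f x0 i)) = 0"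
        "\<exists>x\<in>G. c x \<noteq> 0"
      using Suc.IH[OF G(1,2), of "\<lambda>x i. f x0 n * f x i - f x n * f x0 i"] by auto
    \<comment> \<open>The value at \<open>x0\<close> solves the last equation; the other values
      carry the pivot as a factor and stay nonzero in a domain.\<close>
    define d where "d x = (if x = x0 then - (\<Sum>x\<in>G. c x * f x n) else f x0 n * c x)" for x
    have "(\<Sum>x\<in>F. d x * f x i) = 0" if "i < Suc n" for i
    proof -
      have "(\<Sum>x\<in>G. d x * f x i) = (\<Sum>x\<in>G. f x0 n * c x * f x i)"
        using G(4) by (intro sum.cong) (auto simp: d_def)
      moreover have dx0: "d x0 * f x0 i = - (\<Sum>x\<in>G. c x * f x n * f x0 i)"
        by (simp add: d_def sum_distrib_right)
      ultimately have "(\<Sum>x\<in>F. d x * f x i) = (\<Sum>x\<in>G. c x * (f x0 n * f x i - f x n * f x0 i))"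
        using G dx0 by (simp add: sum_subtractf algebra_simps)
      then show ?thesis
        using c(1) that by (cases "i = n") auto
    qed
    moreover have "\<exists>x\<in>F. d x \<noteq> 0"
      using c(2) x0 G by (auto simp: d_def)
    ultimately show ?thesis by blast
  qed
qed

text \<open>The ambient complex field makes quotients such as
  \<open>D y / (\<tau> y - \<sigma> y)\<close> available, while membership of the results in
  \<open>S\<close> remains a condition.\<close>

locale complex_subring_endos =
  fixes S :: "complex set" and \<sigma> \<tau> :: "complex \<Rightarrow> complex" and R :: "complex ring"
  defines "R \<equiv> complex_field\<lparr>carrier := S\<rparr>"
  assumes sub: "subring S complex_field"
    and \<sigma>: "\<sigma> \<in> ring_endos R" and \<tau>: "\<tau> \<in> ring_endos R"
begin

abbreviation "M \<equiv> st_derivation_module R \<sigma> \<tau>"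

lemma R_simps [simp]:
  "carrier R = S" "x \<otimes>\<^bsub>R\<^esub> y = x * y" "x \<oplus>\<^bsub>R\<^esub> y = x + y" "\<one>\<^bsub>R\<^esub> = 1" "\<zero>\<^bsub>R\<^esub> = 0"
  by (simp_all add: R_def)

lemmas S = subring_complexD[OF sub] subring_complex_of_int[OF sub]

sublocale cring R
  using complex_field.subcring_iff[of S] complex_field.subcringI[OF sub] unfolding R_def
  by (simp add: mult.commute)

lemma ring_endosD:
  assumes "h \<in> ring_endos R"
  shows "x \<in> S \<Longrightarrow> h x \<in> S" "x \<in> S \<Longrightarrow> y \<in> S \<Longrightarrow> h (x + y) = h x + h y"
    "x \<in> S \<Longrightarrow> y \<in> S \<Longrightarrow> h (x * y) = h x * h y"
  using assms by (auto simp: ring_endos_def)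

sublocale M: Module.module int_ring M
  using ring_endosD(1)[OF \<sigma>] ring_endosD(1)[OF \<tau>] by (intro st_derivation_module_is_module cring_axioms) auto

lemma add_pow_R: "x \<in> S \<Longrightarrow> add_pow R (k :: int) x = of_int k * x"
proof -
  assume x: "x \<in> S"
  have nat: "add_pow R (j :: nat) x = of_nat j * x" for j
    using x by (induction j) (simp_all add: algebra_simps)
  \<comment> \<open>Negative multiples use the additive inverse of \<open>R\<close>, which depends
    on its carrier and has to be identified with complex negation.\<close>
  have neg: "\<ominus>\<^bsub>R\<^esub> (of_nat j * x) = - (of_nat j * x)" for j
    using S(5)[OF S(6)[of "int j"] x] S(3)[of "of_nat j * x"] by (intro minus_equality) auto
  show ?thesis
  proof (cases "k \<ge> 0")
    case True
    then show ?thesis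
      using nat[of "nat k"] by (simp add: add_pow_int_ge)
  next
    case False
    then show ?thesis
      using nat[of "nat (- k)"] neg[of "nat (- k)"] by (simp add: add_pow_int_lt)
  qed
qed

text \<open>Serves derivations and endomorphisms alike; it later computes an endomorphism on the
  integers from its value at 1.\<close>

lemma additive_of_int_mult:
  assumes add: "\<And>x y. x \<in> S \<Longrightarrow> y \<in> S \<Longrightarrow> f (x + y) = f x + f y" and x: "x \<in> S"
  shows "f (of_int k * x) = of_int k * (f x :: complex)"
proof (induction k rule: int_induct[of _ 0])
  case base
  show ?case using add[of 0 0] S(1) by simp
next
  case (step1 i)
  have "f (of_int i * x + x) = f (of_int i * x) + f x"
    using S x by (intro add) auto
  with step1 show ?case
    by (simp add: algebra_simps)
next
  case (step2 i)
  have "f (of_int (i - 1) * x + x) = f (of_int (i - 1) * x) + f x"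
    using S(5)[OF S(6) x] x by (intro add)
  moreover have "of_int (i - 1) * x + x = of_int i * x"
    by (simp add: algebra_simps)
  ultimately show ?case
    using step2 by (simp add: left_diff_distrib)
qed

lemma derivation_iff:
  "D \<in> st_derivations R \<sigma> \<tau> \<longleftrightarrow> D \<in> S \<rightarrow>\<^sub>E S \<and>
    (\<forall>x\<in>S. \<forall>y\<in>S. D (x + y) = D x + D y) \<and>
    (\<forall>x\<in>S. \<forall>y\<in>S. D (x * y) = D x * \<tau> y + \<sigma> x * D y)"
  unfolding st_derivations_def using additive_of_int_mult[of D]
  by (auto simp: add_pow_R PiE_mem[of _ S "\<lambda>_. S"])

lemma M_carrier [simp]: "carrier M = st_derivations R \<sigma> \<tau>"
  by (simp add: st_derivation_module_def)

lemma M_eval: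
  assumes "x \<in> S"
  shows "\<zero>\<^bsub>M\<^esub> x = 0" "(D \<oplus>\<^bsub>M\<^esub> E) x = D x + E x"
    "D \<in> carrier M \<Longrightarrow> (k \<odot>\<^bsub>M\<^esub> D) x = of_int k * D x"
  using assms by (auto simp: st_derivation_module_def derivation_iff add_pow_R PiE_mem[of _ S "\<lambda>_. S"])

section \<open>Rank of the derivation module from evaluation at one point\<close>

lemma finsum_closed_eval:
  assumes "finite F" "F \<subseteq> carrier M"
  shows "(\<Oplus>\<^bsub>M\<^esub>v\<in>F. c v \<odot>\<^bsub>M\<^esub> v) \<in> carrier M"
    and "x \<in> S \<Longrightarrow> (\<Oplus>\<^bsub>M\<^esub>v\<in>F. c v \<odot>\<^bsub>M\<^esub> v) x = (\<Sum>v\<in>F. of_int (c v) * v x)"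
proof -
  have cl: "c v \<odot>\<^bsub>M\<^esub> v \<in> carrier M" if "v \<in> carrier M" for v
    using that by (intro M.smult_closed) auto
  show "(\<Oplus>\<^bsub>M\<^esub>v\<in>F. c v \<odot>\<^bsub>M\<^esub> v) \<in> carrier M"
    using assms cl by (intro M.finsum_closed) blast
  show "(\<Oplus>\<^bsub>M\<^esub>v\<in>F. c v \<odot>\<^bsub>M\<^esub> v) x = (\<Sum>v\<in>F. of_int (c v) * v x)" if "x \<in> S"
    using assms
  proof (induction F)
    case (insert v F)
    then have "(\<Oplus>\<^bsub>M\<^esub>v\<in>insert v F. c v \<odot>\<^bsub>M\<^esub> v) = c v \<odot>\<^bsub>M\<^esub> v \<oplus>\<^bsub>M\<^esub> (\<Oplus>\<^bsub>M\<^esub>v\<in>F. c v \<odot>\<^bsub>M\<^esub> v)"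
      using cl by (intro M.finsum_insert) blast+
    with insert show ?case
      by (simp add: M_eval[OF that])
  qed (simp add: M_eval[OF that])
qed

text \<open>Evaluation at \<open>y\<close> is additive and embeds the module as the lattice with
  basis \<open>g\<close>. The preimages of the \<open>g i\<close> therefore form a basis of the
  module, and any larger family is dependent.\<close>

theorem module_rank_by_evaluation:
  fixes g :: "nat \<Rightarrow> complex"
  assumes y: "y \<in> S"
    and inj: "inj_on (\<lambda>D. D y) (st_derivations R \<sigma> \<tau>)"
    and img: "(\<lambda>D. D y) ` st_derivations R \<sigma> \<tau> = {\<Sum>i<n. of_int (k i) * g i | k. True}"
    and indep: "\<And>k. (\<Sum>i<n. of_int (k i) * g i) = 0 \<Longrightarrow> \<forall>i<n. k i = 0"
  shows "module_fin_gen int_ring M \<and> module_has_rank int_ring M n"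
proof -
  have "\<exists>D\<in>carrier M. D y = g i" if "i < n" for i
  proof -
    have "g i = (\<Sum>j<n. of_int (if j = i then 1 else 0) * g j)"
      using that by (simp add: if_distrib[of of_int] if_distrib[of "\<lambda>x. x * _"] cong: if_cong)
    then have "g i \<in> (\<lambda>D. D y) ` st_derivations R \<sigma> \<tau>"
      unfolding img by (intro CollectI exI[of _ "\<lambda>j. if j = i then 1 else 0"] conjI TrueI)
    then show ?thesis by auto
  qed
  then obtain E where E: "\<And>i. i < n \<Longrightarrow> E i \<in> carrier M" "\<And>i. i < n \<Longrightarrow> E i y = g i"
    by metis
  have injE: "inj_on E {..<n}"
  proof
    fix i j assume ij: "i \<in> {..<n}" "j \<in> {..<n}" "E i = E j"
    show "i = j"
    proof (rule ccontr)
      assume "i \<noteq> j"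
      \<comment> \<open>Equal preimages would give \<open>g i = g j\<close>, a relation with
        coefficients 1 and -1.\<close>
      have "(\<Sum>l<n. of_int ((if l = i then 1 else 0) - (if l = j then 1 else 0)) * g l) = g i - g j"
        using ij by (simp add: left_diff_distrib sum_subtractf if_distrib[of of_int]
            if_distrib[of "\<lambda>x. x * _"] cong: if_cong)
      also have "\<dots> = 0"
        using E(2)[of i] E(2)[of j] ij by simp
      finally show False
        using indep[of "\<lambda>l. (if l = i then 1 else 0) - (if l = j then 1 else 0)"] \<open>i \<noteq> j\<close> ij(1) by auto
    qed
  qed
  define B where "B = E ` {..<n}"
  have B: "finite B" "B \<subseteq> carrier M" "card B = n"
    using E(1) injE by (auto simp: B_def card_image)
  have "\<exists>c\<in>B \<rightarrow> carrier int_ring. D = (\<Oplus>\<^bsub>M\<^esub>v\<in>B. c v \<odot>\<^bsub>M\<^esub> v)" if D: "D \<in> carrier M" for D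
  proof -
    have "D y \<in> (\<lambda>D. D y) ` st_derivations R \<sigma> \<tau>"
      using D by simp
    then obtain k where k: "D y = (\<Sum>i<n. of_int (k i) * g i)"
      unfolding img by blast
    define c where "c = k \<circ> inv_into {..<n} E"
    have "(\<Oplus>\<^bsub>M\<^esub>v\<in>B. c v \<odot>\<^bsub>M\<^esub> v) y = (\<Sum>v\<in>B. of_int (c v) * v y)"
      by (rule finsum_closed_eval(2)[OF B(1,2) y])
    also have "\<dots> = D y"
      unfolding B_def k
      by (subst sum.reindex[OF injE], rule sum.cong) (auto simp: c_def E(2) inv_into_f_f[OF injE])
    finally have "D = (\<Oplus>\<^bsub>M\<^esub>v\<in>B. c v \<odot>\<^bsub>M\<^esub> v)"
      using D finsum_closed_eval(1)[OF B(1,2)] inj_onD[OF inj, of D] by simp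
    then show ?thesis
      by (intro bexI[of _ c]) simp_all
  qed
  then have "module_fin_gen int_ring M"
    unfolding module_fin_gen_def using B by blast
  moreover have "module_lin_indep int_ring M B"
    unfolding module_lin_indep_def
  proof (safe del: notI)
    show "v \<in> carrier M" if "v \<in> B" for v
      using that B(2) by blast
  next
    fix F c v
    assume F: "finite F" "F \<subseteq> B" and 0: "(\<Oplus>\<^bsub>M\<^esub>v\<in>F. c v \<odot>\<^bsub>M\<^esub> v) = \<zero>\<^bsub>M\<^esub>" and v: "v \<in> F"
    have "0 = (\<Oplus>\<^bsub>M\<^esub>v\<in>F. c v \<odot>\<^bsub>M\<^esub> v) y"
      by (simp add: 0 M_eval[OF y])
    also have "\<dots> = (\<Sum>v\<in>F. of_int (c v) * v y)"
      using F B(2) y by (intro finsum_closed_eval) auto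
    \<comment> \<open>Coefficients are extended by zero from \<open>F\<close> to all of
      \<open>B\<close>, since independence of \<open>g\<close> is stated for full sums.\<close>
    also have "\<dots> = (\<Sum>v\<in>B. of_int (if v \<in> F then c v else 0) * v y)"
      using F B(1) by (intro sum.mono_neutral_cong_left) auto
    also have "\<dots> = (\<Sum>i<n. of_int (if E i \<in> F then c (E i) else 0) * g i)"
      unfolding B_def by (subst sum.reindex[OF injE], rule sum.cong) (auto simp: E(2))
    finally have "\<forall>i<n. (if E i \<in> F then c (E i) else 0) = 0"
      by (intro indep) simp
    moreover obtain i where "i < n" "v = E i"
      using v F(2) by (auto simp: B_def)
    ultimately show "c v = \<zero>\<^bsub>int_ring\<^esub>"
      using v by auto
  qed
  moreover have "card F \<le> n" if F: "module_lin_indep int_ring M F" "finite F" for F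
  proof (rule ccontr)
    assume "\<not> card F \<le> n"
    have FM: "F \<subseteq> carrier M"
      using F(1) by (simp add: module_lin_indep_def)
    have "\<exists>k. D y = (\<Sum>i<n. of_int (k i) * g i)" if "D \<in> F" for D
    proof -
      have "D y \<in> (\<lambda>D. D y) ` st_derivations R \<sigma> \<tau>"
        using FM that by auto
      then show ?thesis unfolding img by blast
    qed
    then obtain f where f: "\<And>D. D \<in> F \<Longrightarrow> D y = (\<Sum>i<n. of_int (f D i) * g i)"
      by metis
    \<comment> \<open>More than \<open>n\<close> integer coordinate vectors of length
      \<open>n\<close> satisfy a nontrivial relation, which injectivity of evaluation lifts to the
      module.\<close>
    obtain c where c: "\<And>i. i < n \<Longrightarrow> (\<Sum>D\<in>F. c D * f D i) = 0" "\<exists>D\<in>F. c D \<noteq> 0"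
      using nontrivial_relation[OF F(2), of n f] \<open>\<not> card F \<le> n\<close> by auto
    have "(\<Oplus>\<^bsub>M\<^esub>D\<in>F. c D \<odot>\<^bsub>M\<^esub> D) y = (\<Sum>D\<in>F. of_int (c D) * D y)"
      by (rule finsum_closed_eval(2)[OF F(2) FM y])
    also have "\<dots> = (\<Sum>D\<in>F. \<Sum>i<n. of_int (c D * f D i) * g i)"
      by (intro sum.cong) (auto simp: f sum_distrib_left mult.assoc)
    also have "\<dots> = (\<Sum>i<n. of_int (\<Sum>D\<in>F. c D * f D i) * g i)"
      by (subst sum.swap) (simp add: sum_distrib_right)
    also have "\<dots> = \<zero>\<^bsub>M\<^esub> y"
      by (simp add: c(1) M_eval[OF y])
    finally have "(\<Oplus>\<^bsub>M\<^esub>D\<in>F. c D \<odot>\<^bsub>M\<^esub> D) = \<zero>\<^bsub>M\<^esub>"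
      using finsum_closed_eval(1)[OF F(2) FM] M.zero_closed
      by (intro inj_onD[OF inj]) simp_all
    then have "\<forall>D\<in>F. c D = 0"
      using F unfolding module_lin_indep_def by auto
    with c(2) show False by auto
  qed
  ultimately show ?thesis
    unfolding module_has_rank_def using B by blast
qed

section \<open>Derivations as multiples of \<tau> - \<sigma>, and endomorphisms at square
  roots\<close>

lemma derivation_eq:
  assumes D: "D \<in> st_derivations R \<sigma> \<tau>" and "x \<in> S" "y \<in> S" "\<tau> y \<noteq> \<sigma> y"
  shows "D x = D y * (\<tau> x - \<sigma> x) / (\<tau> y - \<sigma> y)"
proof -
  have "D x * \<tau> y + \<sigma> x * D y = D (x * y)"
    using D assms by (simp add: derivation_iff)
  also have "\<dots> = D (y * x)"
    by (simp add: mult.commute)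
  also have "\<dots> = D y * \<tau> x + \<sigma> y * D x"
    using D assms by (simp add: derivation_iff)
  finally show ?thesis
    using assms(4) by (simp add: field_simps)
qed

lemma inj_on_eval:
  assumes "y \<in> S" "\<tau> y \<noteq> \<sigma> y"
  shows "inj_on (\<lambda>D. D y) (st_derivations R \<sigma> \<tau>)"
proof
  fix D E assume DE: "D \<in> st_derivations R \<sigma> \<tau>" "E \<in> st_derivations R \<sigma> \<tau>" "D y = E y"
  show "D = E"
  proof (rule extensionalityI[of _ S])
    show "D \<in> extensional S" "E \<in> extensional S"
      using DE by (auto simp: derivation_iff PiE_def)
    show "D x = E x" if "x \<in> S" for x
      using derivation_eq[OF DE(1) that assms] derivation_eq[OF DE(2) that assms] DE(3) by simp
  qed
qed

text \<open>Conversely, every multiple \<open>c * (\<tau> x - \<sigma> x)\<close> obeys the twisted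
  Leibniz rule because the mixed terms \<open>\<sigma> x * \<tau> y\<close> cancel; only its values
  must lie in \<open>S\<close>. Taking \<open>x = y\<close> shows that \<open>d\<close> itself lies
  in \<open>S\<close>.\<close>

lemma eval_image:
  assumes "y \<in> S" "\<tau> y \<noteq> \<sigma> y"
  shows "(\<lambda>D. D y) ` st_derivations R \<sigma> \<tau> =
    {d. \<forall>x\<in>S. d * (\<tau> x - \<sigma> x) / (\<tau> y - \<sigma> y) \<in> S}"
proof safe
  fix D x assume D: "D \<in> st_derivations R \<sigma> \<tau>" and x: "x \<in> S"
  have "D x \<in> S"
    using D x by (auto simp: derivation_iff)
  then show "D y * (\<tau> x - \<sigma> x) / (\<tau> y - \<sigma> y) \<in> S"
    using derivation_eq[OF D x assms] by simp
next
  fix d assume d: "\<forall>x\<in>S. d * (\<tau> x - \<sigma> x) / (\<tau> y - \<sigma> y) \<in> S"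
  define c where "c = d / (\<tau> y - \<sigma> y)"
  define D where "D = (\<lambda>x\<in>S. c * (\<tau> x - \<sigma> x))"
  have c: "c * (\<tau> x - \<sigma> x) \<in> S" if "x \<in> S" for x
    using d that by (simp add: c_def)
  have "D \<in> st_derivations R \<sigma> \<tau>"
    unfolding derivation_iff using c S(4,5) ring_endosD[OF \<sigma>] ring_endosD[OF \<tau>]
    by (simp add: D_def) (simp add: algebra_simps)
  moreover have "D y = d"
    using assms by (simp add: D_def c_def)
  ultimately show "d \<in> (\<lambda>D. D y) ` st_derivations R \<sigma> \<tau>"
    by blast
qed

text \<open>Endomorphisms need not be unital by definition, but a nonzero value can be cancelled
  from \<open>h x = h 1 * h x\<close>.\<close>

lemma endo_one:
  assumes h: "h \<in> ring_endos R" and "\<exists>x\<in>S. h x \<noteq> 0"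
  shows "h 1 = 1"
proof -
  obtain x where "x \<in> S" "h x \<noteq> 0" using assms by auto
  moreover have "h x = h 1 * h x"
    using ring_endosD(3)[OF h S(2) \<open>x \<in> S\<close>] by simp
  ultimately show ?thesis by simp
qed

text \<open>A unital endomorphism fixes the integers, so the image of \<open>a\<close> has the same
  square as \<open>a\<close>.\<close>

lemma endo_sqrt:
  assumes h: "h \<in> ring_endos R" and "h 1 = 1" "a \<in> S" "a * a = of_int m"
  shows "h a = a \<or> h a = - a"
proof -
  have "h a * h a = h (of_int m * 1)"
    using ring_endosD(3)[OF h assms(3,3)] by (simp add: assms)
  also have "\<dots> = a * a"
    using additive_of_int_mult[of h 1 m] ring_endosD(2)[OF h] S(2) assms by simp
  finally show ?thesis
    by (simp add: square_eq_iff)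
qed

end

section \<open>The biquadratic case\<close>

theorem corollary3p19:
  fixes m n :: int and \<sigma> \<tau> :: "complex \<Rightarrow> complex"
  assumes "squarefree m" and "squarefree n" and "m \<noteq> n"
    and "ring.dimension complex_field 4 \<rat> (biquad_field m n)"
    and "\<sigma> \<in> ring_endos (biquad_ring m n)" and "\<tau> \<in> ring_endos (biquad_ring m n)"
    and "\<exists>x\<in>carrier (biquad_ring m n). \<sigma> x \<noteq> \<zero>\<^bsub>biquad_ring m n\<^esub>"
    and "\<exists>x\<in>carrier (biquad_ring m n). \<tau> x \<noteq> \<zero>\<^bsub>biquad_ring m n\<^esub>"
    and "\<exists>x\<in>carrier (biquad_ring m n). \<sigma> x \<noteq> \<tau> x"
  shows "module_fin_gen int_ring (st_derivation_module (biquad_ring m n) \<sigma> \<tau>) \<and>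
    module_has_rank int_ring (st_derivation_module (biquad_ring m n) \<sigma> \<tau>) 4"
proof -
  define a b where "a = csqrt (of_int m)" "b = csqrt (of_int n)"
  have sq: "a * a = of_int m" "b * b = of_int n"
    using power2_csqrt[of "of_int m"] power2_csqrt[of "of_int n"]
    by (simp_all add: a_b_def power2_eq_square)
  have indep: "p = 0" "q = 0" "r = 0" "s = 0"
    if "of_int p + of_int q * a + of_int r * b + of_int s * (a * b) = 0" for p q r s
    using biquad_independent[OF assms(4), of p q r s] that by (simp_all add: a_b_def)
  have uniq: "p = p' \<and> q = q' \<and> r = r' \<and> s = s'"
    if "of_int p + of_int q * a + of_int r * b + of_int s * (a * b)
      = of_int p' + of_int q' * a + of_int r' * b + of_int s' * (a * b)" for p q r s p' q' r' s'
    using indep[of "p - p'" "q - q'" "r - r'" "s - s'"] that by (simp add: algebra_simps)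
  \<comment> \<open>If \<open>a\<close> vanished, the coefficients \<open>0, 1, 0, 0\<close> would
    contradict independence.\<close>
  have "m \<noteq> 0" "a \<noteq> 0"
    using indep(2)[of 0 1 0 0] sq by auto
  define A where "A = generate_ring complex_field {a, b}"
  have A: "A = {of_int p + of_int q * a + of_int r * b + of_int s * (a * b) | p q r s. True}"
    unfolding A_def by (rule generate_ring_sqrt[OF sq])
  have R: "biquad_ring m n = complex_field\<lparr>carrier := A\<rparr>"
    by (simp add: biquad_ring_def A_def a_b_def)
  have "subring A complex_field"
    unfolding A_def by (rule complex_field.generate_ring_is_subring) simp
  interpret complex_subring_endos A \<sigma> \<tau> "biquad_ring m n"
    using \<open>subring A _\<close> assms(5,6) by (intro complex_subring_endos.intro) (simp_all only: R)
  have ab: "a \<in> A" "b \<in> A"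
    unfolding A_def by (auto intro: generate_ring.incl)
  have one: "\<sigma> 1 = 1" "\<tau> 1 = 1"
    using assms(5-8) by (auto intro!: endo_one)
  note sgn = endo_sqrt[OF \<sigma> one(1) ab(1) sq(1)] endo_sqrt[OF \<tau> one(2) ab(1) sq(1)]
    endo_sqrt[OF \<sigma> one(1) ab(2) sq(2)] endo_sqrt[OF \<tau> one(2) ab(2) sq(2)]
  define \<delta> where "\<delta> x = \<tau> x - \<sigma> x" for x
  \<comment> \<open>The last term is the twisted Leibniz rule for \<open>\<delta>\<close> at
    \<open>a * b\<close>; so \<open>\<delta>\<close> is determined by its values at \<open>a\<close>
    and \<open>b\<close>, given \<sigma> and \<tau>.\<close>
  have \<delta>: "\<delta> (of_int p + of_int q * a + of_int r * b + of_int s * (a * b)) =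
      of_int q * \<delta> a + of_int r * \<delta> b + of_int s * (\<delta> a * \<tau> b + \<sigma> a * \<delta> b)" for p q r s
  proof -
    have "h (of_int p + of_int q * a + of_int r * b + of_int s * (a * b)) =
        of_int p + of_int q * h a + of_int r * h b + of_int s * (h a * h b)"
      if h: "h \<in> ring_endos (biquad_ring m n)" and "h 1 = 1" for h
    proof -
      have "h (of_int k) = of_int k" for k
        using additive_of_int_mult[OF ring_endosD(2)[OF h] S(2), of k] \<open>h 1 = 1\<close> by simp
      then show ?thesis
        by (simp add: ring_endosD(2,3)[OF h] S(4-6) ab)
    qed
    from this[OF \<sigma> one(1)] this[OF \<tau> one(2)] show ?thesis
      by (simp add: \<delta>_def algebra_simps)
  qed
  \<comment> \<open>The condition for all \<open>x\<close> reduces to \<open>a\<close> and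
    \<open>b\<close>, since \<open>d * \<delta> x / \<delta> y\<close> is a combination of those two
    quotients with coefficients in \<open>A\<close>.\<close>
  have image: "(\<lambda>D. D y) ` st_derivations (biquad_ring m n) \<sigma> \<tau> =
      {d. d * (\<delta> a / \<delta> y) \<in> A \<and> d * (\<delta> b / \<delta> y) \<in> A}" if "y \<in> A" "\<delta> y \<noteq> 0" for y
  proof -
    have "d * \<delta> x / \<delta> y \<in> A"
      if d: "d * (\<delta> a / \<delta> y) \<in> A" "d * (\<delta> b / \<delta> y) \<in> A" and "x \<in> A" for d x
    proof -
      obtain p q r s where x: "x = of_int p + of_int q * a + of_int r * b + of_int s * (a * b)"
        using \<open>x \<in> A\<close> unfolding A by blast
      have "d * \<delta> x / \<delta> y = of_int q * (d * (\<delta> a / \<delta> y)) + of_int r * (d * (\<delta> b / \<delta> y))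
          + of_int s * (d * (\<delta> a / \<delta> y) * \<tau> b + \<sigma> a * (d * (\<delta> b / \<delta> y)))"
        unfolding x \<delta> by (simp add: add_divide_distrib algebra_simps)
      also have "\<dots> \<in> A"
        by (intro S(4) S(5)[OF S(6)] S(5)[OF d(1)] S(5)[OF _ d(2)] d ring_endosD(1)[OF \<sigma>] ring_endosD(1)[OF \<tau>] ab)
      finally show ?thesis .
    qed
    moreover have "\<tau> y \<noteq> \<sigma> y"
      using \<open>\<delta> y \<noteq> 0\<close> by (simp add: \<delta>_def)
    ultimately show ?thesis
      using ab unfolding eval_image[OF \<open>y \<in> A\<close> \<open>\<tau> y \<noteq> \<sigma> y\<close>] by (auto simp flip: \<delta>_def)
  qed
  define u where "u i = [1, a, b, a * b] ! i" for i
  \<comment> \<open>In every case the admissible values form a diagonal sublattice: \<open>e\<close>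
    lists the nonzero factors by which the basis \<open>u\<close> is stretched.\<close>
  have rank: ?thesis
    if y: "y \<in> A" "\<delta> y \<noteq> 0" and e: "\<forall>i<4. e i \<noteq> 0"
      and I: "\<And>d. d * (\<delta> a / \<delta> y) \<in> A \<and> d * (\<delta> b / \<delta> y) \<in> A \<longleftrightarrow>
        (\<exists>p q r s. d = of_int (p * e 0) + of_int (q * e 1) * a + of_int (r * e 2) * b
           + of_int (s * e 3) * (a * b))" for y and e :: "nat \<Rightarrow> int"
  proof -
    have sum4: "(\<Sum>i<4. of_int (k i) * (of_int (e i) * u i)) =
        of_int (k 0 * e 0) + of_int (k 1 * e 1) * a + of_int (k 2 * e 2) * b
           + of_int (k 3 * e 3) * (a * b)" for k
      by (simp add: eval_nat_numeral u_def algebra_simps)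
    have "(\<exists>p q r s. d = of_int (p * e 0) + of_int (q * e 1) * a + of_int (r * e 2) * b
           + of_int (s * e 3) * (a * b)) \<longleftrightarrow>
        (\<exists>k. d = (\<Sum>i<4. of_int (k i) * (of_int (e i) * u i)))" for d
    proof safe
      fix p q r s
      show "\<exists>k. of_int (p * e 0) + of_int (q * e 1) * a + of_int (r * e 2) * b
           + of_int (s * e 3) * (a * b) = (\<Sum>i<4. of_int (k i) * (of_int (e i) * u i))"
        unfolding sum4 by (rule exI[of _ "\<lambda>i. [p, q, r, s] ! i"]) (simp add: eval_nat_numeral)
    qed (use sum4 in blast)
    then have "(\<lambda>D. D y) ` st_derivations (biquad_ring m n) \<sigma> \<tau> =
        {\<Sum>i<4. of_int (k i) * (of_int (e i) * u i) | k. True}"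
      using image[OF y] I by auto
    moreover have "\<forall>i<4. k i = 0" if "(\<Sum>i<4. of_int (k i) * (of_int (e i) * u i)) = 0" for k
      using indep[OF that[unfolded sum4]] e by (simp add: All_less_Suc eval_nat_numeral)
    ultimately show ?thesis
      using y inj_on_eval[of y] by (intro module_rank_by_evaluation) (auto simp: \<delta>_def)
  qed
  have full: "d \<in> A \<longleftrightarrow> (\<exists>p q r s. d = of_int (p * 1) + of_int (q * 1) * a + of_int (r * 1) * b
           + of_int (s * 1) * (a * b))" for d
    unfolding A by simp
  consider "\<delta> a = 0" | "\<delta> a \<noteq> 0" "\<delta> b = 0" | "\<delta> a \<noteq> 0" "\<delta> b \<noteq> 0" by blast
  then show ?thesis
  proof cases
    case 1
    have "\<delta> b \<noteq> 0"
    proof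
      assume "\<delta> b = 0"
      obtain x where x: "x \<in> A" "\<sigma> x \<noteq> \<tau> x" using assms(9) by auto
      then have "\<delta> x = 0"
        using \<delta> 1 \<open>\<delta> b = 0\<close> unfolding A by auto
      with x show False by (simp add: \<delta>_def)
    qed
    \<comment> \<open>At \<open>y = b\<close> the two conditions become \<open>0 \<in> A\<close> and
      \<open>d \<in> A\<close>.\<close>
    then show ?thesis
      using 1 ab S(1) full by (intro rank[of b "\<lambda>_. 1"]) simp_all
  next
    case 2
    then show ?thesis
      using ab S(1) full by (intro rank[of a "\<lambda>_. 1"]) simp_all
  next
    case 3
    \<comment> \<open>Where \<sigma> and \<tau> differ on a root they take opposite signs, so
      \<open>\<delta> a\<close> is \<open>2 * a\<close> up to sign, and likewise for
      \<open>b\<close>. The sign of the ratio does not affect membership in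
      \<open>A\<close>.\<close>
    then have "\<delta> b / \<delta> a = b / a \<or> \<delta> b / \<delta> a = - (b / a)"
      using sgn \<open>a \<noteq> 0\<close> by (auto simp: \<delta>_def field_simps)
    then have ratio: "d * (\<delta> b / \<delta> a) = d * (b / a) \<or> d * (\<delta> b / \<delta> a) = - (d * (b / a))" for d
      by (elim disjE) (simp_all only: mult_minus_right simp_thms)
    have neg: "- z \<in> A \<longleftrightarrow> z \<in> A" for z
      using S(3)[of z] S(3)[of "- z"] by auto
    have quot: "d * (\<delta> b / \<delta> a) \<in> A \<longleftrightarrow> d * (b / a) \<in> A" for d
      using ratio[of d] by (rule disjE) (simp_all only: neg)
    define g m' n' where "g = gcd m n" "m' = m div g" "n' = n div g"
    have g: "m = m' * g" "n = n' * g" "coprime m' n'"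
      using \<open>m \<noteq> 0\<close> by (simp_all add: g_m'_n'_def div_gcd_coprime)
    with \<open>m \<noteq> 0\<close> have "g \<noteq> 0" "m' \<noteq> 0"
      by (metis mult_zero_left mult_zero_right)+
    have "d \<in> A \<and> d * (b / a) \<in> A \<longleftrightarrow>
        (\<exists>p q r s. d = of_int (p * m) + of_int (q * 1) * a + of_int (r * m') * b
           + of_int (s * 1) * (a * b))" for d
    proof safe
      assume "d \<in> A" "d * (b / a) \<in> A"
      then obtain p q r s p' q' r' s'
        where d: "d = of_int p + of_int q * a + of_int r * b + of_int s * (a * b)"
          and d': "d * (b / a) = of_int p' + of_int q' * a + of_int r' * b + of_int s' * (a * b)"
        unfolding A by blast
      \<comment> \<open>Multiplying by \<open>m = a * a\<close> clears the denominator. Comparing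
        coordinates gives \<open>p = s' * m\<close> and \<open>r * n = m * q'\<close>; after
        division by the gcd, coprimality forces \<open>m'\<close> to divide
        \<open>r\<close>.\<close>
      have "of_int m * (d * (b / a)) = d * a * b"
        using \<open>a \<noteq> 0\<close> by (simp flip: sq)
      also have "\<dots> = of_int p * (a * b) + of_int q * (a * a) * b + of_int r * (b * b) * a
          + of_int s * (a * a) * (b * b)"
        by (simp add: d algebra_simps)
      finally have "of_int (s * m * n) + of_int (r * n) * a + of_int (q * m) * b + of_int p * (a * b)
        = of_int (m * p') + of_int (m * q') * a + of_int (m * r') * b + of_int (m * s') * (a * b)"
        unfolding d' sq by (simp add: algebra_simps)
      from uniq[OF this] have p: "p = s' * m" and "r * n = m * q'"
        by simp_all
      then have "(r * n') * g = (m' * q') * g"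
        by (simp add: g(1,2) ac_simps)
      then have "r * n' = m' * q'"
        using \<open>g \<noteq> 0\<close> by simp
      then have "m' dvd r"
        using g(3) by (metis coprime_dvd_mult_left_iff dvd_triv_left)
      then obtain r'' where "r = r'' * m'"
        by (metis dvd_def mult.commute)
      with p d show "\<exists>p q r s. d = of_int (p * m) + of_int (q * 1) * a + of_int (r * m') * b
           + of_int (s * 1) * (a * b)"
        by (metis mult.right_neutral)
    next
      fix p q r s
      let ?d = "of_int (p * m) + of_int (q * 1) * a + of_int (r * m') * b + of_int (s * 1) * (a * b)"
      show "?d \<in> A"
        by (intro S(4-6) ab)
      define t where "t = b / a"
      have t: "a * t = b"
        using \<open>a \<noteq> 0\<close> by (simp add: t_def)
      have "of_int m * t = a * b"
        unfolding sq(1)[symmetric] mult.assoc t ..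
      moreover have "of_int m' * b * t = of_int n' * a"
      proof -
        \<comment> \<open>Both sides equal \<open>m' * n' * g\<close>; this is why the factor
          \<open>m'\<close> suffices at \<open>b\<close>.\<close>
        have "of_int m' * (b * b) = of_int n' * (a * a)"
          unfolding sq by (simp add: g(1,2) ac_simps)
        then have "(of_int m' * b * t) * a = (of_int n' * a) * a"
          by (simp add: t mult.assoc mult.commute[of t a])
        then show ?thesis
          using \<open>a \<noteq> 0\<close> by simp
      qed
      moreover have "?d * t = of_int p * (of_int m * t) + of_int r * (of_int m' * b * t)
          + of_int q * (a * t) + of_int s * (a * t) * b"
        by (simp add: algebra_simps)
      ultimately have "?d * (b / a)
          = of_int p * (a * b) + of_int r * (of_int n' * a) + of_int q * b + of_int s * b * b"
        unfolding t t_def[symmetric] by simp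
      also have "\<dots> \<in> A"
        by (intro S(4-6) ab)
      finally show "?d * (b / a) \<in> A" .
    qed
    then show ?thesis
      using 3 ab \<open>m \<noteq> 0\<close> \<open>m' \<noteq> 0\<close> quot by (intro rank[of a "\<lambda>i. if i = 0 then m else if i = 2 then m' else 1"]) simp_all
  qed
qed

end
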